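(* Let $U\subset\mathbb{R}^2$ be open and let $x:U\to\mathbb{R}^3$ and $\xi:U\to S^2$ be proper frontals with the same singular sets, $\Sigma(x)=\Sigma(\xi)$, such that $\xi$ is the unit normal vector field of $x$. Then a curve on $x$ is a Kummer principal line of the congruence $\{x,\xi\}$ if and only if it is a line of curvature of $x$.
   Context: A frontal is a smooth map $f:U\to\mathbb{R}^3$ admitting locally a smooth unit vector field orthogonal to $f_{u_1},f_{u_2}$; proper means its singular set $\Sigma(f)=\{u:f\text{ not immersive at }u\}$ has empty interior. A tangent moving basis $\Omega=(w_1\ w_2)$ of $x$ is a smooth $3\times2$ matrix valued map with linearly independent columns whose span contains $x_{u_1},x_{u_2}$; choose it with $\xi=w_1\times w_2/\|w_1\times w_2\|$, so $\Omega$ is also a tangent moving basis of $\xi$. Write $Dx=\Omega\Lambda_\Omega^T$, $D\xi=\Omega\Delta_\Omega^T$, $\lambda_\Omega=\det\Lambda_\Omega$, $\mathbf{I}_\Omega=\Omega^T\Omega$, $\mathbf{II}_\Omega=-\Omega^TD\xi$, $\mu_\Omega=-\mathbf{II}_\Omega^T\mathbf{I}_\Omega^{-1}$, $\alpha_\Omega=\mu_\Omega\mathrm{adj}(\Lambda_\Omega)$, $\mathbf{P}=\begin{pmatrix}0&1\\-1&0\end{pmatrix}$. A curve $\gamma$ in $U$ is a line of curvature of the frontal $x$ when $\lambda_\Omega\,\gamma'^T\mathbf{P}\alpha_\Omega^T(\gamma)\gamma'=0$. Kummer principal line: with $\boldsymbol{\mathcal{I}}_\Omega=\Omega^T\Omega$,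 $\boldsymbol{\mathcal{II}}_\Omega=-\Omega^TDx$, and $\mathscr{K}_q^\Omega(b)=\frac{b^T\boldsymbol{\mathcal{II}}_\Omega(q)\mathrm{adj}(\Delta_\Omega(q)^T)b}{b^T\boldsymbol{\mathcal{I}}_\Omega(q)b}$ ($b\ne0$), a curve $\gamma$ is a Kummer principal line if for every $t$ with $b=\Delta_\Omega^T(\gamma(t))\gamma'(t)\neq0$, $\mathscr{K}_{\gamma(t)}^\Omega(b)$ is an extreme (maximum or minimum) value of $\mathscr{K}_{\gamma(t)}^\Omega$. *)

theory Defs
  imports "HOL-Analysis.Analysis"
begin

text \<open>C^k and C^infinity maps on an (open) set, via iterated partial (directional)
  derivatives along the standard basis.\<close>
fun Ck_on :: "nat \<Rightarrow> 'a::euclidean_space set \<Rightarrow> ('a \<Rightarrow> 'b::real_normed_vector) \<Rightarrow> bool" where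
  "Ck_on 0 U f = continuous_on U f"
| "Ck_on (Suc k) U f = ((\<forall>u\<in>U. f differentiable (at u)) \<and>
      (\<forall>i\<in>Basis. Ck_on k U (\<lambda>u. frechet_derivative f (at u) i)))"

definition smooth_on :: "'a::euclidean_space set \<Rightarrow> ('a \<Rightarrow> 'b::real_normed_vector) \<Rightarrow> bool" where
  "smooth_on U f \<longleftrightarrow> (\<forall>k. Ck_on k U f)"

text \<open>Frontals U \<subseteq> R^2 \<rightarrow> R^3.\<close>
definition frontal :: "(real^2) set \<Rightarrow> (real^2 \<Rightarrow> real^3) \<Rightarrow> bool" where
  "frontal U f \<longleftrightarrow> smooth_on U f \<and>
     (\<forall>u\<in>U. \<exists>V n. open V \<and> u \<in> V \<and> V \<subseteq> U \<and> smooth_on V n \<and>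
        (\<forall>v\<in>V. norm (n v) = 1 \<and> (\<forall>i\<in>Basis. n v \<bullet> frechet_derivative f (at v) i = 0)))"

definition singular_set :: "(real^2) set \<Rightarrow> (real^2 \<Rightarrow> real^3) \<Rightarrow> (real^2) set" where
  "singular_set U f = {u \<in> U. \<not> inj (frechet_derivative f (at u))}"

definition proper_frontal :: "(real^2) set \<Rightarrow> (real^2 \<Rightarrow> real^3) \<Rightarrow> bool" where
  "proper_frontal U f \<longleftrightarrow> frontal U f \<and> interior (singular_set U f) = {}"

text \<open>xi is the unit normal vector field of x.\<close>
definition unit_normal_of :: "(real^2) set \<Rightarrow> (real^2 \<Rightarrow> real^3) \<Rightarrow> (real^2 \<Rightarrow> real^3) \<Rightarrow> bool" where
  "unit_normal_of U x \<xi> \<longleftrightarrow> smooth_on U \<xi> \<and>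
     (\<forall>u\<in>U. norm (\<xi> u) = 1 \<and> (\<forall>i\<in>Basis. \<xi> u \<bullet> frechet_derivative x (at u) i = 0))"

text \<open>Jacobian matrix (3x2) of a map R^2 \<rightarrow> R^3.\<close>
definition jac :: "(real^2 \<Rightarrow> real^3) \<Rightarrow> real^2 \<Rightarrow> real^2^3" where
  "jac f u = matrix (frechet_derivative f (at u))"

text \<open>Tangent moving basis Omega = (w1 w2) of x, chosen so that xi = w1 \<times> w2 / |w1 \<times> w2|.\<close>
definition tangent_moving_basis :: "(real^2) set \<Rightarrow> (real^2 \<Rightarrow> real^3) \<Rightarrow> (real^2 \<Rightarrow> real^3)
     \<Rightarrow> (real^2 \<Rightarrow> real^2^3) \<Rightarrow> bool" where
  "tangent_moving_basis U x \<xi> \<Omega> \<longleftrightarrow> smooth_on U \<Omega> \<and>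
     (\<forall>u\<in>U. (\<forall>a b. a *\<^sub>R column 1 (\<Omega> u) + b *\<^sub>R column 2 (\<Omega> u) = 0 \<longrightarrow> a = 0 \<and> b = 0) \<and>
        (\<forall>i\<in>Basis. frechet_derivative x (at u) i \<in> span {column 1 (\<Omega> u), column 2 (\<Omega> u)}) \<and>
        \<xi> u = (1 / norm (cross3 (column 1 (\<Omega> u)) (column 2 (\<Omega> u)))) *\<^sub>R (cross3 (column 1 (\<Omega> u)) (column 2 (\<Omega> u))))"

text \<open>Adjugate of a 2x2 matrix and the matrix P.\<close>
definition adj2 :: "real^2^2 \<Rightarrow> real^2^2" where
  "adj2 A = vector [vector [A$2$2, - A$1$2], vector [- A$2$1, A$1$1]]"

definition Pmat :: "real^2^2" where
  "Pmat = vector [vector [0, 1], vector [-1, 0]]"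

text \<open>Line of curvature of the frontal x (w.r.t. Omega, Lambda, Delta with
  Dx = Omega Lambda^T, Dxi = Omega Delta^T).\<close>
definition alpha_mat :: "(real^2 \<Rightarrow> real^2^3) \<Rightarrow> (real^2 \<Rightarrow> real^3) \<Rightarrow> (real^2 \<Rightarrow> real^2^2)
     \<Rightarrow> real^2 \<Rightarrow> real^2^2" where
  "alpha_mat \<Omega> \<xi> \<Lambda> u =
     (let I = transpose (\<Omega> u) ** \<Omega> u;
          II = - (transpose (\<Omega> u) ** jac \<xi> u);
          \<mu> = - (transpose II ** matrix_inv I)
      in \<mu> ** adj2 (\<Lambda> u))"

definition line_of_curvature :: "(real^2 \<Rightarrow> real^2^3) \<Rightarrow> (real^2 \<Rightarrow> real^3) \<Rightarrow> (real^2 \<Rightarrow> real^2^2)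
     \<Rightarrow> real set \<Rightarrow> (real \<Rightarrow> real^2) \<Rightarrow> bool" where
  "line_of_curvature \<Omega> \<xi> \<Lambda> I \<gamma> \<longleftrightarrow>
     (\<forall>t\<in>I. det (\<Lambda> (\<gamma> t)) *
        (vector_derivative \<gamma> (at t) \<bullet>
          ((Pmat ** transpose (alpha_mat \<Omega> \<xi> \<Lambda> (\<gamma> t))) *v vector_derivative \<gamma> (at t))) = 0)"

text \<open>Kummer's function K_q^Omega(b).\<close>
definition kummer_K :: "(real^2 \<Rightarrow> real^2^3) \<Rightarrow> (real^2 \<Rightarrow> real^3) \<Rightarrow> (real^2 \<Rightarrow> real^2^2)
     \<Rightarrow> real^2 \<Rightarrow> real^2 \<Rightarrow> real" where
  "kummer_K \<Omega> x \<Delta> q b =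
     (let I = transpose (\<Omega> q) ** \<Omega> q;
          II = - (transpose (\<Omega> q) ** jac x q)
      in (b \<bullet> ((II ** adj2 (transpose (\<Delta> q))) *v b)) / (b \<bullet> (I *v b)))"

definition kummer_principal_line :: "(real^2 \<Rightarrow> real^2^3) \<Rightarrow> (real^2 \<Rightarrow> real^3) \<Rightarrow> (real^2 \<Rightarrow> real^2^2)
     \<Rightarrow> real set \<Rightarrow> (real \<Rightarrow> real^2) \<Rightarrow> bool" where
  "kummer_principal_line \<Omega> x \<Delta> I \<gamma> \<longleftrightarrow>
     (\<forall>t\<in>I. let q = \<gamma> t; b = transpose (\<Delta> q) *v vector_derivative \<gamma> (at t) in
        b \<noteq> 0 \<longrightarrow>
          ((\<forall>c. c \<noteq> 0 \<longrightarrow> kummer_K \<Omega> x \<Delta> q c \<le> kummer_K \<Omega> x \<Delta> q b) \<or>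
           (\<forall>c. c \<noteq> 0 \<longrightarrow> kummer_K \<Omega> x \<Delta> q b \<le> kummer_K \<Omega> x \<Delta> q c)))"

end

theory Submission
  imports Defs
begin

text \<open>
  Fix a point \<open>q\<close> and put \<open>g = \<Omega>\<^sup>T \<Omega>\<close>. Kummer's function is then the ratio of the binary
  quadratic forms \<open>c \<mapsto> - c\<^sup>T g \<Lambda>\<^sup>T adj(\<Delta>\<^sup>T) c\<close> and \<open>c \<mapsto> c\<^sup>T g c\<close>, the second one
  positive definite. The value of such a ratio at \<open>b \<noteq> 0\<close> is extremal exactly when the Jacobian
  of the two forms vanishes at \<open>b\<close>. For \<open>b = \<Delta>\<^sup>T v\<close> an algebraic identity turns this Jacobian
  into \<open>- det \<Delta> det g\<close> times the line-of-curvature expression of \<open>v\<close>, as soon as the matrix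
  \<open>\<Lambda> g \<Delta>\<^sup>T = (x\<^sub>i \<bullet> \<xi>\<^sub>j)\<close> is symmetric; this symmetry holds because
  \<open>\<xi>\<^sub>j \<bullet> x\<^sub>i = - \<xi> \<bullet> x\<^sub>i\<^sub>j\<close> and mixed partials commute. Finally \<open>\<Sigma>(x) = \<Sigma>(\<xi>)\<close> says that
  \<open>det \<Lambda>\<close> and \<open>det \<Delta>\<close> vanish together, which disposes of the factor \<open>det \<Delta>\<close> and of the
  case \<open>b = 0\<close>.
\<close>

section \<open>Extremal values of a ratio of binary quadratic forms\<close>

definition binary_form :: "real \<Rightarrow> real \<Rightarrow> real \<Rightarrow> real^2 \<Rightarrow> real" where
  "binary_form a h k c = a * (c$1)\<^sup>2 + 2 * h * c$1 * c$2 + k * (c$2)\<^sup>2"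

text \<open>One quarter of the Jacobian determinant of the forms \<open>(a, h, k)\<close> and \<open>(p, q, r)\<close> at \<open>b\<close>.\<close>
definition binary_form_jacobian :: "real \<Rightarrow> real \<Rightarrow> real \<Rightarrow> real \<Rightarrow> real \<Rightarrow> real \<Rightarrow> real^2 \<Rightarrow> real" where
  "binary_form_jacobian a h k p q r b =
     (a * b$1 + h * b$2) * (q * b$1 + r * b$2) - (h * b$1 + k * b$2) * (p * b$1 + q * b$2)"

definition extremal_on :: "('a \<Rightarrow> real) \<Rightarrow> 'a set \<Rightarrow> 'a \<Rightarrow> bool" where
  "extremal_on f S b \<longleftrightarrow> (\<forall>c\<in>S. f c \<le> f b) \<or> (\<forall>c\<in>S. f b \<le> f c)"

lemma vec2_eq_0_iff: "(c::real^2) = 0 \<longleftrightarrow> c$1 = 0 \<and> c$2 = 0"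
  by (auto simp: vec_eq_iff forall_2)

lemma binary_form_0 [simp]: "binary_form a h k 0 = 0"
  by (simp add: binary_form_def)

lemma binary_form_uminus: "binary_form (- a) (- h) (- k) c = - binary_form a h k c"
  by (simp add: binary_form_def)

lemma binary_form_translate_axis:
  "binary_form a h k (b + t *\<^sub>R axis 1 1) = binary_form a h k b + 2 * t * (a * b$1 + h * b$2) + t\<^sup>2 * a"
  "binary_form a h k (b + t *\<^sub>R axis 2 1) = binary_form a h k b + 2 * t * (h * b$1 + k * b$2) + t\<^sup>2 * k"
  by (simp_all add: binary_form_def axis_def algebra_simps power2_eq_square)

lemma linear_coeff_zero_if_quadratic_nonpos:
  fixes \<beta> m :: real
  assumes "\<And>t. 2 * t * \<beta> + t\<^sup>2 * m \<le> 0"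
  shows "\<beta> = 0"
proof (rule ccontr)
  assume "\<beta> \<noteq> 0"
  define s where "s = 1 / (\<bar>m\<bar> + 1)"
  have "s > 0" by (simp add: s_def add_pos_nonneg)
  have "\<bar>s * m\<bar> < 1"
    by (simp add: s_def abs_mult)
  then have "s * m > -1" by linarith
  have "2 * (s * \<beta>) * \<beta> + (s * \<beta>)\<^sup>2 * m = s * \<beta>\<^sup>2 * (2 + s * m)"
    by (simp add: algebra_simps power2_eq_square)
  also have "\<dots> > 0"
    using \<open>\<beta> \<noteq> 0\<close> \<open>s > 0\<close> \<open>s * m > -1\<close> by (intro mult_pos_pos) auto
  finally show False using assms[of "s * \<beta>"] by linarith
qed

lemma binary_form_kernel_if_nonpos:
  assumes "\<And>c. binary_form a h k c \<le> 0" and "binary_form a h k b = 0"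
  shows "a * b$1 + h * b$2 = 0" and "h * b$1 + k * b$2 = 0"
proof -
  show "a * b$1 + h * b$2 = 0"
    by (rule linear_coeff_zero_if_quadratic_nonpos[of _ a])
      (metis assms binary_form_translate_axis(1) add_0)
  show "h * b$1 + k * b$2 = 0"
    by (rule linear_coeff_zero_if_quadratic_nonpos[of _ k])
      (metis assms binary_form_translate_axis(2) add_0)
qed

lemma binary_form_kernel_if_semidefinite:
  assumes "(\<forall>c. binary_form a h k c \<le> 0) \<or> (\<forall>c. 0 \<le> binary_form a h k c)"
    and "binary_form a h k b = 0"
  shows "a * b$1 + h * b$2 = 0 \<and> h * b$1 + k * b$2 = 0"
  using assms
proof (elim disjE)
  assume "\<forall>c. 0 \<le> binary_form a h k c"
  then have "(- a) * b$1 + (- h) * b$2 = 0 \<and> (- h) * b$1 + (- k) * b$2 = 0"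
    using binary_form_kernel_if_nonpos[of "- a" "- h" "- k" b] assms(2)
    by (simp add: binary_form_uminus)
  then show ?thesis by linarith
qed (use binary_form_kernel_if_nonpos in blast)

text \<open>A nonzero kernel vector forces the discriminant to vanish, so the form is \<open>\<pm>\<close> a square.\<close>
lemma binary_form_semidefinite_if_kernel:
  fixes b :: "real^2"
  assumes "b \<noteq> 0" and ker: "a * b$1 + h * b$2 = 0" "h * b$1 + k * b$2 = 0"
  shows "(\<forall>c. binary_form a h k c \<le> 0) \<or> (\<forall>c. 0 \<le> binary_form a h k c)"
proof -
  have "(a * k - h\<^sup>2) * b$1 = k * (a * b$1 + h * b$2) - h * (h * b$1 + k * b$2)"
    and "(a * k - h\<^sup>2) * b$2 = a * (h * b$1 + k * b$2) - h * (a * b$1 + h * b$2)"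
    by (simp_all add: algebra_simps power2_eq_square)
  then have disc: "a * k = h\<^sup>2"
    using ker \<open>b \<noteq> 0\<close> by (auto simp: vec2_eq_0_iff)
  have square: "a * binary_form a h k c = (a * c$1 + h * c$2)\<^sup>2" for c
    using disc by (simp add: binary_form_def algebra_simps power2_eq_square)
  consider "a > 0" | "a < 0" | "a = 0" "k \<ge> 0" | "a = 0" "k < 0"
    by linarith
  then show ?thesis
  proof cases
    case 1
    then have "0 \<le> binary_form a h k c" for c
      using square[of c] by (metis zero_le_power2 zero_le_mult_iff not_le)
    then show ?thesis by blast
  next
    case 2
    then have "binary_form a h k c \<le> 0" for c
      using square[of c] by (metis zero_le_power2 mult_neg_pos not_le)
    then show ?thesis by blast
  next
    case 3
    then show ?thesis using disc by (simp add: binary_form_def)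
  next
    case 4
    then show ?thesis using disc by (simp add: binary_form_def mult_nonpos_nonneg)
  qed
qed

lemma binary_form_jacobian_eq_0_iff_kernel:
  assumes "binary_form a h k b = 0" and "binary_form p q r b \<noteq> 0"
  shows "binary_form_jacobian a h k p q r b = 0 \<longleftrightarrow> a * b$1 + h * b$2 = 0 \<and> h * b$1 + k * b$2 = 0"
proof -
  define J where "J = binary_form_jacobian a h k p q r b"
  have "(a * b$1 + h * b$2) * binary_form p q r b = (p * b$1 + q * b$2) * binary_form a h k b + b$2 * J"
    and "(h * b$1 + k * b$2) * binary_form p q r b = (q * b$1 + r * b$2) * binary_form a h k b - b$1 * J"
    unfolding J_def binary_form_jacobian_def binary_form_def by (simp_all add: algebra_simps power2_eq_square)
  then show ?thesis
    using assms by (auto simp: J_def binary_form_jacobian_def)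
qed

lemma binary_form_jacobian_diff_multiple:
  "binary_form_jacobian (a - \<kappa> * p) (h - \<kappa> * q) (k - \<kappa> * r) p q r b = binary_form_jacobian a h k p q r b"
  by (simp add: binary_form_jacobian_def algebra_simps)

lemma extremal_binary_form_ratio_iff:
  fixes b :: "real^2"
  assumes pos: "\<And>c. c \<noteq> 0 \<Longrightarrow> binary_form p q r c > 0" and "b \<noteq> 0"
  shows "extremal_on (\<lambda>c. binary_form a h k c / binary_form p q r c) (- {0}) b
    \<longleftrightarrow> binary_form_jacobian a h k p q r b = 0"
proof -
  txt \<open>With \<open>\<kappa>\<close> the value at \<open>b\<close>, extremality means that the form \<open>M\<close> below is semidefinite;
    since \<open>M\<close> vanishes at \<open>b\<close>, this happens iff \<open>b\<close> lies in its kernel.\<close>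
  define \<kappa> where "\<kappa> = binary_form a h k b / binary_form p q r b"
  define M where "M = binary_form (a - \<kappa> * p) (h - \<kappa> * q) (k - \<kappa> * r)"
  have M_eq: "M c = binary_form a h k c - \<kappa> * binary_form p q r c" for c
    by (simp add: M_def binary_form_def algebra_simps)
  have "M b = 0"
    using pos[OF \<open>b \<noteq> 0\<close>] by (simp add: M_eq \<kappa>_def)
  have le_iff: "binary_form a h k c / binary_form p q r c \<le> \<kappa> \<longleftrightarrow> M c \<le> 0"
    and ge_iff: "\<kappa> \<le> binary_form a h k c / binary_form p q r c \<longleftrightarrow> 0 \<le> M c" if "c \<noteq> 0" for c
    using pos[OF that] by (simp_all add: M_eq pos_divide_le_eq pos_le_divide_eq)
  have "extremal_on (\<lambda>c. binary_form a h k c / binary_form p q r c) (- {0}) b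
      \<longleftrightarrow> (\<forall>c. M c \<le> 0) \<or> (\<forall>c. 0 \<le> M c)"
    unfolding extremal_on_def \<kappa>_def[symmetric] using le_iff ge_iff by (force simp: M_def)
  also have "\<dots> \<longleftrightarrow> (a - \<kappa> * p) * b$1 + (h - \<kappa> * q) * b$2 = 0 \<and> (h - \<kappa> * q) * b$1 + (k - \<kappa> * r) * b$2 = 0"
    using binary_form_kernel_if_semidefinite binary_form_semidefinite_if_kernel \<open>b \<noteq> 0\<close> \<open>M b = 0\<close>
    unfolding M_def by blast
  also have "\<dots> \<longleftrightarrow> binary_form_jacobian a h k p q r b = 0"
    using binary_form_jacobian_eq_0_iff_kernel[of "a - \<kappa> * p" "h - \<kappa> * q" "k - \<kappa> * r" b p q r]
      \<open>M b = 0\<close> pos[OF \<open>b \<noteq> 0\<close>]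
    by (simp add: M_def binary_form_jacobian_diff_multiple)
  finally show ?thesis .
qed

section \<open>Kummer's function at a point\<close>

lemma inner_matrix_vector_eq_binary_form:
  fixes A :: "real^2^2"
  shows "c \<bullet> (A *v c) = binary_form (A$1$1) ((A$1$2 + A$2$1) / 2) (A$2$2) c"
  by (simp add: binary_form_def matrix_vector_mult_def sum_2 inner_vec_def algebra_simps power2_eq_square)

lemma kummer_jacobian_identity:
  fixes g L D :: "real^2^2" and v :: "real^2"
  assumes g_sym: "g$2$1 = g$1$2"
  defines "N \<equiv> (- (g ** transpose L)) ** adj2 (transpose D)"
    and "S \<equiv> L ** g ** transpose D"
    and "b \<equiv> transpose D *v v"
  shows "2 * binary_form_jacobian (N$1$1) ((N$1$2 + N$2$1) / 2) (N$2$2) (g$1$1) (g$1$2) (g$2$2) b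
    = (S$2$1 - S$1$2) * (b \<bullet> (g *v b)) - 2 * det D * det g * (v \<bullet> ((Pmat ** transpose (D ** adj2 L)) *v v))"
  unfolding N_def S_def b_def
  apply (simp add: g_sym det_2 adj2_def Pmat_def binary_form_jacobian_def matrix_matrix_mult_def
      matrix_vector_mult_def sum_2 inner_vec_def transpose_def)
  by (simp add: field_simps)

lemma det_nonzero_if_positive_definite:
  fixes A :: "real^'n^'n"
  assumes pos: "\<And>c. c \<noteq> 0 \<Longrightarrow> 0 < c \<bullet> (A *v c)"
  shows "det A \<noteq> 0"
proof
  assume "det A = 0"
  then obtain a c where "a \<noteq> c" "A *v a = A *v c"
    using det_nz_iff_inj[of "(*v) A"] unfolding inj_def by auto
  then have "A *v (a - c) = 0" "a - c \<noteq> 0"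
    by (simp_all add: matrix_vector_mult_diff_distrib)
  then show False using pos[of "a - c"] by simp
qed

lemma kummer_extremal_iff_curvature_condition:
  fixes g L D :: "real^2^2" and v :: "real^2"
  assumes g_symmetric: "transpose g = g" and g_pos: "\<And>c. c \<noteq> 0 \<Longrightarrow> 0 < c \<bullet> (g *v c)"
    and S_symmetric: "transpose (L ** g ** transpose D) = L ** g ** transpose D"
    and singular: "det L = 0 \<longleftrightarrow> det D = 0"
  defines "b \<equiv> transpose D *v v"
  shows "(b \<noteq> 0 \<longrightarrow>
      extremal_on (\<lambda>c. (c \<bullet> (((- (g ** transpose L)) ** adj2 (transpose D)) *v c)) / (c \<bullet> (g *v c))) (- {0}) b)
    \<longleftrightarrow> det L * (v \<bullet> ((Pmat ** transpose (D ** adj2 L)) *v v)) = 0"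
proof -
  have transpose_entry: "A$2$1 = A$1$2" if "transpose A = A" for A :: "real^2^2"
    using arg_cong[OF that, of "\<lambda>A. A$1$2"] by (simp add: transpose_def)
  note g_sym = transpose_entry[OF g_symmetric] and S_sym = transpose_entry[OF S_symmetric]
  define N where "N = (- (g ** transpose L)) ** adj2 (transpose D)"
  define E where "E = v \<bullet> ((Pmat ** transpose (D ** adj2 L)) *v v)"
  have ratio: "(\<lambda>c. (c \<bullet> (N *v c)) / (c \<bullet> (g *v c)))
      = (\<lambda>c. binary_form (N$1$1) ((N$1$2 + N$2$1) / 2) (N$2$2) c / binary_form (g$1$1) (g$1$2) (g$2$2) c)"
    by (simp add: inner_matrix_vector_eq_binary_form g_sym)
  have "binary_form_jacobian (N$1$1) ((N$1$2 + N$2$1) / 2) (N$2$2) (g$1$1) (g$1$2) (g$2$2) b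
      = - det D * det g * E"
    using kummer_jacobian_identity[OF g_sym, of L D v] S_sym unfolding N_def E_def b_def by simp
  moreover have "0 < binary_form (g$1$1) (g$1$2) (g$2$2) c" if "c \<noteq> 0" for c
    using g_pos[OF that] by (simp add: inner_matrix_vector_eq_binary_form g_sym)
  ultimately have extremal_iff:
    "extremal_on (\<lambda>c. (c \<bullet> (N *v c)) / (c \<bullet> (g *v c))) (- {0}) b \<longleftrightarrow> det D * E = 0" if "b \<noteq> 0"
    using extremal_binary_form_ratio_iff[OF _ that, of "g$1$1" "g$1$2" "g$2$2" "N$1$1" "(N$1$2 + N$2$1) / 2" "N$2$2"]
      det_nonzero_if_positive_definite[OF g_pos]
    unfolding ratio by simp
  have "E = v \<bullet> ((Pmat ** transpose (adj2 L)) *v b)"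
    unfolding E_def b_def by (simp only: matrix_transpose_mul matrix_vector_mul_assoc matrix_mul_assoc)
  then have "b = 0 \<Longrightarrow> E = 0" by simp
  then show ?thesis
    using extremal_iff singular unfolding N_def[symmetric] E_def[symmetric]
    by (cases "det L = 0") auto
qed

section \<open>Symmetry of the matrix \<open>(x\<^sub>i \<bullet> \<xi>\<^sub>j)\<close>\<close>

lemma norm_scaleR_add_le:
  fixes a b :: "'a::real_normed_vector"
  assumes "0 \<le> s" "s \<le> h" "0 \<le> t" "t \<le> h"
  shows "norm (s *\<^sub>R a + t *\<^sub>R b) \<le> h * (norm a + norm b)"
proof -
  have "norm (s *\<^sub>R a + t *\<^sub>R b) \<le> s * norm a + t * norm b"
    using norm_triangle_ineq[of "s *\<^sub>R a" "t *\<^sub>R b"] assms by simp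
  also have "\<dots> \<le> h * norm a + h * norm b"
    using assms by (intro add_mono mult_right_mono) auto
  finally show ?thesis by (simp add: distrib_left)
qed

lemma mixed_second_difference_mvt:
  fixes f fa fab :: "'v::real_normed_vector \<Rightarrow> real"
  assumes "0 < h"
    and box: "\<And>s t. 0 \<le> s \<Longrightarrow> s \<le> h \<Longrightarrow> 0 \<le> t \<Longrightarrow> t \<le> h \<Longrightarrow> u + s *\<^sub>R a + t *\<^sub>R b \<in> U"
    and fa: "\<And>p s. p + s *\<^sub>R a \<in> U \<Longrightarrow> ((\<lambda>t. f (p + t *\<^sub>R a)) has_real_derivative fa (p + s *\<^sub>R a)) (at s)"
    and fab: "\<And>p s. p + s *\<^sub>R b \<in> U \<Longrightarrow> ((\<lambda>t. fa (p + t *\<^sub>R b)) has_real_derivative fab (p + s *\<^sub>R b)) (at s)"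
  shows "\<exists>\<sigma> \<tau>. 0 < \<sigma> \<and> \<sigma> < h \<and> 0 < \<tau> \<and> \<tau> < h \<and>
    f (u + h *\<^sub>R a + h *\<^sub>R b) - f (u + h *\<^sub>R b) - f (u + h *\<^sub>R a) + f u = h * h * fab (u + \<sigma> *\<^sub>R a + \<tau> *\<^sub>R b)"
proof -
  define G where "G s = f (u + h *\<^sub>R b + s *\<^sub>R a) - f (u + s *\<^sub>R a)" for s
  have "\<exists>\<sigma>. 0 < \<sigma> \<and> \<sigma> < h \<and> G h - G 0 = (h - 0) * (fa (u + h *\<^sub>R b + \<sigma> *\<^sub>R a) - fa (u + \<sigma> *\<^sub>R a))"
  proof (rule MVT2[OF \<open>0 < h\<close>])
    fix s assume "0 \<le> s" "s \<le> h"
    then have "u + h *\<^sub>R b + s *\<^sub>R a \<in> U" "u + s *\<^sub>R a \<in> U"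
      using box[of s h] box[of s 0] \<open>0 < h\<close> by (simp_all add: add_ac)
    then show "(G has_real_derivative (fa (u + h *\<^sub>R b + s *\<^sub>R a) - fa (u + s *\<^sub>R a))) (at s)"
      unfolding G_def by (intro DERIV_diff fa)
  qed
  then obtain \<sigma> where \<sigma>: "0 < \<sigma>" "\<sigma> < h"
    and G: "G h - G 0 = h * (fa (u + \<sigma> *\<^sub>R a + h *\<^sub>R b) - fa (u + \<sigma> *\<^sub>R a + 0 *\<^sub>R b))"
    by (auto simp: add_ac)
  have "\<exists>\<tau>. 0 < \<tau> \<and> \<tau> < h \<and>
      fa (u + \<sigma> *\<^sub>R a + h *\<^sub>R b) - fa (u + \<sigma> *\<^sub>R a + 0 *\<^sub>R b) = (h - 0) * fab (u + \<sigma> *\<^sub>R a + \<tau> *\<^sub>R b)"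
    using \<sigma> by (intro MVT2[OF \<open>0 < h\<close>] fab box) auto
  then obtain \<tau> where "0 < \<tau>" "\<tau> < h"
    and "fa (u + \<sigma> *\<^sub>R a + h *\<^sub>R b) - fa (u + \<sigma> *\<^sub>R a + 0 *\<^sub>R b) = h * fab (u + \<sigma> *\<^sub>R a + \<tau> *\<^sub>R b)"
    by auto
  with \<sigma> G show ?thesis
    unfolding G_def by (intro exI[of _ \<sigma>] exI[of _ \<tau>]) (simp add: add_ac)
qed

lemma eq_if_coincide_arbitrarily_near:
  fixes f g :: "'a::metric_space \<Rightarrow> 'b::metric_space"
  assumes "continuous (at u) f" and "continuous (at u) g"
    and near: "\<And>\<delta>. 0 < \<delta> \<Longrightarrow> \<exists>p p'. dist p u < \<delta> \<and> dist p' u < \<delta> \<and> f p = g p'"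
  shows "f u = g u"
proof (rule ccontr)
  assume "f u \<noteq> g u"
  define e where "e = dist (f u) (g u) / 2"
  have "e > 0" using \<open>f u \<noteq> g u\<close> by (simp add: e_def)
  obtain d1 where "d1 > 0" and d1: "\<And>p. dist p u < d1 \<Longrightarrow> dist (f p) (f u) < e"
    using assms(1) \<open>e > 0\<close> unfolding continuous_at_eps_delta by blast
  obtain d2 where "d2 > 0" and d2: "\<And>p. dist p u < d2 \<Longrightarrow> dist (g p) (g u) < e"
    using assms(2) \<open>e > 0\<close> unfolding continuous_at_eps_delta by blast
  obtain p p' where "dist p u < min d1 d2" "dist p' u < min d1 d2" and "f p = g p'"
    using near[of "min d1 d2"] \<open>d1 > 0\<close> \<open>d2 > 0\<close> by auto
  then have "dist (f p) (f u) < e" "dist (g p') (g u) < e"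
    using d1[of p] d2[of p'] by simp_all
  moreover have "dist (f u) (g u) \<le> dist (f p) (f u) + dist (g p') (g u)"
    using dist_triangle[of "f u" "g u" "f p"] \<open>f p = g p'\<close> by (simp add: dist_commute)
  ultimately show False unfolding e_def by linarith
qed

text \<open>Schwarz's theorem: up to the factor \<open>h\<^sup>2\<close>, both mixed partials are values of the same second
  difference of \<open>f\<close> over a small square, taken at points tending to \<open>u\<close>.\<close>
lemma mixed_partials_eq:
  fixes f fa fb fab fba :: "'v::real_normed_vector \<Rightarrow> real"
  assumes "open U" "u \<in> U"
    and fa: "\<And>p s. p + s *\<^sub>R a \<in> U \<Longrightarrow> ((\<lambda>t. f (p + t *\<^sub>R a)) has_real_derivative fa (p + s *\<^sub>R a)) (at s)"
    and fb: "\<And>p s. p + s *\<^sub>R b \<in> U \<Longrightarrow> ((\<lambda>t. f (p + t *\<^sub>R b)) has_real_derivative fb (p + s *\<^sub>R b)) (at s)"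
    and fab: "\<And>p s. p + s *\<^sub>R b \<in> U \<Longrightarrow> ((\<lambda>t. fa (p + t *\<^sub>R b)) has_real_derivative fab (p + s *\<^sub>R b)) (at s)"
    and fba: "\<And>p s. p + s *\<^sub>R a \<in> U \<Longrightarrow> ((\<lambda>t. fb (p + t *\<^sub>R a)) has_real_derivative fba (p + s *\<^sub>R a)) (at s)"
    and "continuous (at u) fab" and "continuous (at u) fba"
  shows "fab u = fba u"
proof (rule eq_if_coincide_arbitrarily_near[OF assms(7,8)])
  fix \<delta> :: real assume "0 < \<delta>"
  obtain r where "r > 0" "ball u r \<subseteq> U" using assms(1,2) open_contains_ball by blast
  define K where "K = norm a + norm b + 1"
  define h where "h = min r \<delta> / (2 * K)"
  have "K > 0" by (simp add: K_def add_nonneg_pos)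
  then have "0 < h" "h * K < r" "h * K < \<delta>"
    using \<open>r > 0\<close> \<open>0 < \<delta>\<close> by (auto simp: h_def field_simps min_def)
  have near: "dist (u + s *\<^sub>R a + t *\<^sub>R b) u < min r \<delta>"
    if "0 \<le> s" "s \<le> h" "0 \<le> t" "t \<le> h" for s t
  proof -
    have "dist (u + s *\<^sub>R a + t *\<^sub>R b) u \<le> h * (norm a + norm b)"
      using norm_scaleR_add_le[OF that] by (simp add: dist_norm)
    also have "\<dots> \<le> h * K" using \<open>0 < h\<close> by (simp add: K_def)
    finally show ?thesis using \<open>h * K < r\<close> \<open>h * K < \<delta>\<close> by simp
  qed
  then have box: "u + s *\<^sub>R a + t *\<^sub>R b \<in> U" "u + t *\<^sub>R b + s *\<^sub>R a \<in> U"
    if "0 \<le> s" "s \<le> h" "0 \<le> t" "t \<le> h" for s t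
    using that \<open>ball u r \<subseteq> U\<close> by (force simp: dist_commute add_ac)+
  obtain \<sigma> \<tau> where "0 < \<sigma>" "\<sigma> < h" "0 < \<tau>" "\<tau> < h" and ab:
      "f (u + h *\<^sub>R a + h *\<^sub>R b) - f (u + h *\<^sub>R b) - f (u + h *\<^sub>R a) + f u = h * h * fab (u + \<sigma> *\<^sub>R a + \<tau> *\<^sub>R b)"
    using mixed_second_difference_mvt[OF \<open>0 < h\<close> box(1) fa fab] by blast
  obtain \<sigma>' \<tau>' where "0 < \<sigma>'" "\<sigma>' < h" "0 < \<tau>'" "\<tau>' < h" and ba:
      "f (u + h *\<^sub>R b + h *\<^sub>R a) - f (u + h *\<^sub>R a) - f (u + h *\<^sub>R b) + f u = h * h * fba (u + \<sigma>' *\<^sub>R b + \<tau>' *\<^sub>R a)"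
    using mixed_second_difference_mvt[OF \<open>0 < h\<close> box(2) fb fba] by blast
  have "h * h * fab (u + \<sigma> *\<^sub>R a + \<tau> *\<^sub>R b) = h * h * fba (u + \<tau>' *\<^sub>R a + \<sigma>' *\<^sub>R b)"
    using ab ba by (simp add: algebra_simps)
  then have "fab (u + \<sigma> *\<^sub>R a + \<tau> *\<^sub>R b) = fba (u + \<tau>' *\<^sub>R a + \<sigma>' *\<^sub>R b)"
    using \<open>0 < h\<close> by simp
  moreover have "dist (u + \<sigma> *\<^sub>R a + \<tau> *\<^sub>R b) u < \<delta>" "dist (u + \<tau>' *\<^sub>R a + \<sigma>' *\<^sub>R b) u < \<delta>"
    using near[of \<sigma> \<tau>] near[of \<tau>' \<sigma>'] \<open>0 < \<sigma>\<close> \<open>\<sigma> < h\<close> \<open>0 < \<tau>\<close> \<open>\<tau> < h\<close> \<open>0 < \<sigma>'\<close> \<open>\<sigma>' < h\<close>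
      \<open>0 < \<tau>'\<close> \<open>\<tau>' < h\<close> by auto
  ultimately show "\<exists>p p'. dist p u < \<delta> \<and> dist p' u < \<delta> \<and> fab p = fba p'" by blast
qed

lemma has_real_derivative_inner_along_line:
  fixes F :: "'a::real_normed_vector \<Rightarrow> 'b::real_inner"
  assumes "F differentiable (at (p + s *\<^sub>R a))"
  shows "((\<lambda>t. w \<bullet> F (p + t *\<^sub>R a)) has_real_derivative (w \<bullet> frechet_derivative F (at (p + s *\<^sub>R a)) a)) (at s)"
proof -
  define F' where "F' = frechet_derivative F (at (p + s *\<^sub>R a))"
  have F': "(F has_derivative F') (at (p + s *\<^sub>R a))"
    using assms unfolding F'_def frechet_derivative_works .
  have "((\<lambda>t. p + t *\<^sub>R a) has_derivative (\<lambda>t. t *\<^sub>R a)) (at s)"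
    by (auto intro!: derivative_eq_intros)
  from has_derivative_compose[OF this F']
  have "((\<lambda>t. w \<bullet> F (p + t *\<^sub>R a)) has_derivative (\<lambda>t. w \<bullet> F' (t *\<^sub>R a))) (at s)"
    by (rule bounded_linear.has_derivative[OF bounded_linear_inner_right])
  moreover have "(\<lambda>t. w \<bullet> F' (t *\<^sub>R a)) = (\<lambda>t. (w \<bullet> F' a) * t)"
    using linear_scale[OF has_derivative_linear[OF F']] by (simp add: mult.commute)
  ultimately show ?thesis
    unfolding has_field_derivative_def F'_def[symmetric] by simp
qed

lemma frechet_derivative_inner_vanishing:
  fixes \<xi> X :: "'a::real_normed_vector \<Rightarrow> 'b::real_inner"
  assumes "open U" "u \<in> U" "\<xi> differentiable (at u)" "X differentiable (at u)"
    and "\<And>w. w \<in> U \<Longrightarrow> \<xi> w \<bullet> X w = 0"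
  shows "frechet_derivative \<xi> (at u) e \<bullet> X u + \<xi> u \<bullet> frechet_derivative X (at u) e = 0"
proof -
  have "((\<lambda>w. \<xi> w \<bullet> X w) has_derivative
      (\<lambda>h. \<xi> u \<bullet> frechet_derivative X (at u) h + frechet_derivative \<xi> (at u) h \<bullet> X u)) (at u)"
    using assms(3,4) by (intro has_derivative_inner) (simp_all add: frechet_derivative_works[symmetric])
  moreover have "((\<lambda>w. \<xi> w \<bullet> X w) has_derivative (\<lambda>h. 0)) (at u)"
    by (rule has_derivative_transform_within_open[of "\<lambda>w. 0" _ u UNIV U]) (use assms in auto)
  ultimately have "(\<lambda>h. \<xi> u \<bullet> frechet_derivative X (at u) h + frechet_derivative \<xi> (at u) h \<bullet> X u) = (\<lambda>h. 0)"
    by (rule has_derivative_unique)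
  then show ?thesis by (metis add.commute)
qed

lemma smooth_on_differentiable: "smooth_on U f \<Longrightarrow> u \<in> U \<Longrightarrow> f differentiable (at u)"
  using Ck_on.simps(2)[of 0 U f] by (auto simp: smooth_on_def)

lemma smooth_on_continuous: "smooth_on U f \<Longrightarrow> continuous_on U f"
  using Ck_on.simps(1)[of U f] by (auto simp: smooth_on_def)

lemma smooth_on_partial_derivative:
  "smooth_on U f \<Longrightarrow> i \<in> Basis \<Longrightarrow> smooth_on U (\<lambda>u. frechet_derivative f (at u) i)"
  unfolding smooth_on_def by (metis Ck_on.simps(2))

text \<open>Differentiating \<open>\<xi> \<bullet> x\<^sub>i = 0\<close> in direction \<open>j\<close> gives \<open>\<xi>\<^sub>j \<bullet> x\<^sub>i = - \<xi> \<bullet> x\<^sub>i\<^sub>j\<close>,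
  which is symmetric in \<open>i, j\<close> by Schwarz's theorem.\<close>
lemma normal_derivative_inner_symmetric:
  fixes x \<xi> :: "'a::euclidean_space \<Rightarrow> 'b::real_inner"
  assumes "open U" "u \<in> U" and x: "smooth_on U x" and \<xi>: "smooth_on U \<xi>"
    and normal: "\<And>w i. w \<in> U \<Longrightarrow> i \<in> Basis \<Longrightarrow> \<xi> w \<bullet> frechet_derivative x (at w) i = 0"
    and "i \<in> Basis" "j \<in> Basis"
  shows "frechet_derivative \<xi> (at u) j \<bullet> frechet_derivative x (at u) i
       = frechet_derivative \<xi> (at u) i \<bullet> frechet_derivative x (at u) j"
proof -
  define X where "X k w = frechet_derivative x (at w) k" for k w
  have X: "smooth_on U (X k)" if "k \<in> Basis" for k
    unfolding X_def using smooth_on_partial_derivative[OF x that] .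
  have second_partial_continuous: "continuous (at u) (\<lambda>w. \<xi> u \<bullet> frechet_derivative (X k) (at w) l)"
    if "k \<in> Basis" "l \<in> Basis" for k l
    using smooth_on_continuous[OF smooth_on_partial_derivative[OF X[OF that(1)] that(2)]] assms(1,2)
    by (intro continuous_intros) (simp add: continuous_on_eq_continuous_at)
  have product_rule: "frechet_derivative \<xi> (at u) l \<bullet> X k u + \<xi> u \<bullet> frechet_derivative (X k) (at u) l = 0"
    if "k \<in> Basis" for k l
  proof (rule frechet_derivative_inner_vanishing[OF assms(1,2)])
    show "\<xi> w \<bullet> X k w = 0" if "w \<in> U" for w
      using normal[OF that \<open>k \<in> Basis\<close>] by (simp add: X_def)
  qed (use assms(2) smooth_on_differentiable[OF \<xi>] smooth_on_differentiable[OF X[OF that]] in auto)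
  have line_x: "((\<lambda>t. \<xi> u \<bullet> x (p + t *\<^sub>R k)) has_real_derivative \<xi> u \<bullet> X k (p + s *\<^sub>R k)) (at s)"
    if "p + s *\<^sub>R k \<in> U" for p s k
    unfolding X_def using that smooth_on_differentiable[OF x]
    by (intro has_real_derivative_inner_along_line) auto
  have line_X: "((\<lambda>t. \<xi> u \<bullet> X k (p + t *\<^sub>R l)) has_real_derivative
      \<xi> u \<bullet> frechet_derivative (X k) (at (p + s *\<^sub>R l)) l) (at s)"
    if "k \<in> Basis" "p + s *\<^sub>R l \<in> U" for p s k l
    using that smooth_on_differentiable[OF X[OF that(1)]]
    by (intro has_real_derivative_inner_along_line) auto
  have "\<xi> u \<bullet> frechet_derivative (X i) (at u) j = \<xi> u \<bullet> frechet_derivative (X j) (at u) i"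
    using mixed_partials_eq[OF assms(1,2) line_x line_x line_X[OF \<open>i \<in> Basis\<close>] line_X[OF \<open>j \<in> Basis\<close>]
        second_partial_continuous[OF \<open>i \<in> Basis\<close> \<open>j \<in> Basis\<close>] second_partial_continuous[OF \<open>j \<in> Basis\<close> \<open>i \<in> Basis\<close>]] .
  then show ?thesis
    using product_rule[OF \<open>i \<in> Basis\<close>, of j] product_rule[OF \<open>j \<in> Basis\<close>, of i]
    by (simp add: X_def)
qed

section \<open>Tangent moving bases\<close>

lemma inj_matrix_vector_mult_if_columns_independent:
  fixes W :: "real^2^'m"
  assumes "\<forall>a b. a *\<^sub>R column 1 W + b *\<^sub>R column 2 W = 0 \<longrightarrow> a = 0 \<and> b = 0"
  shows "inj ((*v) W)"
proof -
  have "c = 0" if "W *v c = 0" for c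
  proof -
    have "W *v c = c$1 *\<^sub>R column 1 W + c$2 *\<^sub>R column 2 W"
      by (simp add: matrix_mult_sum sum_2 scalar_mult_eq_scaleR)
    then have "c$1 = 0 \<and> c$2 = 0"
      using assms that by metis
    then show ?thesis by (simp add: vec_eq_iff forall_2)
  qed
  then show ?thesis
    unfolding linear_inj_iff_eq_0[OF matrix_vector_mul_linear] by blast
qed

lemma inner_gram_matrix: "c \<bullet> ((transpose W ** W) *v c) = (W *v c) \<bullet> (W *v c)"
  for W :: "real^'n^'m"
proof -
  have "c \<bullet> ((transpose W ** W) *v c) = c \<bullet> (transpose W *v (W *v c))"
    by (simp only: matrix_vector_mul_assoc)
  also have "\<dots> = c \<bullet> ((W *v c) v* W)"
    by simp
  also have "\<dots> = ((W *v c) v* W) \<bullet> c"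
    by (rule inner_commute)
  also have "\<dots> = (W *v c) \<bullet> (W *v c)"
    by (rule dot_lmul_matrix)
  finally show ?thesis .
qed

lemma gram_matrix_positive_definite:
  fixes W :: "real^'n^'m"
  assumes "inj ((*v) W)" and "c \<noteq> 0"
  shows "0 < c \<bullet> ((transpose W ** W) *v c)"
proof -
  have "W *v c \<noteq> 0"
    using assms unfolding linear_inj_iff_eq_0[OF matrix_vector_mul_linear] by blast
  then show ?thesis by (simp add: inner_gram_matrix)
qed

lemma transpose_gram_matrix: "transpose (transpose W ** W) = transpose W ** W"
  for W :: "real^'n^'m"
  by (simp add: matrix_transpose_mul)

lemma inner_mult_axis: "(A *v axis i 1) \<bullet> (B *v axis j 1) = (transpose A ** B)$i$j"
  for A B :: "real^'n^'m"
  by (simp add: matrix_vector_mult_basis column_def inner_vec_def matrix_matrix_mult_def transpose_def)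

lemma transpose_uminus: "transpose (- A) = - transpose A"
  for A :: "real^'n^'m"
  by (simp add: transpose_def vec_eq_iff)

lemma matrix_mul_uminus_left: "(- A) ** B = - (A ** B)"
  for A :: "real^'n^'m"
  by (simp add: matrix_matrix_mult_def vec_eq_iff sum_negf)

lemma matrix_inv_right:
  fixes A :: "real^'n^'n"
  assumes "invertible A"
  shows "A ** matrix_inv A = mat 1"
  using someI_ex[OF assms[unfolded invertible_def]] by (simp add: matrix_inv_def)

lemma jac_mult:
  assumes "f differentiable (at q)"
  shows "jac f q *v c = frechet_derivative f (at q) c"
proof -
  have "linear (frechet_derivative f (at q))"
    using assms frechet_derivative_works has_derivative_linear by blast
  then show ?thesis
    unfolding jac_def by (simp add: matrix_works linear_matrix_vector_mul_eq[symmetric])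
qed

lemma singular_set_iff_det:
  assumes "inj ((*v) W)" and "x differentiable (at q)" and "jac x q = W ** transpose L" and "q \<in> U"
  shows "q \<in> singular_set U x \<longleftrightarrow> det L = 0"
proof -
  have "frechet_derivative x (at q) = (*v) W \<circ> (*v) (transpose L)"
    unfolding fun_eq_iff comp_def matrix_vector_mul_assoc assms(3)[symmetric] jac_mult[OF assms(2)]
    by simp
  then have "inj (frechet_derivative x (at q)) \<longleftrightarrow> inj ((*v) (transpose L))"
    using inj_compose[OF assms(1)] inj_on_imageI2 by auto
  also have "\<dots> \<longleftrightarrow> det L \<noteq> 0"
    using det_nz_iff_inj[OF matrix_vector_mul_linear[of "transpose L"], symmetric]
    by (simp only: matrix_of_matrix_vector_mul det_transpose)
  finally show ?thesis
    using assms(4) by (simp add: singular_set_def)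
qed

lemma alpha_mat_eq:
  assumes "jac \<xi> q = \<Omega> q ** transpose (\<Delta> q)" and "invertible (transpose (\<Omega> q) ** \<Omega> q)"
  shows "alpha_mat \<Omega> \<xi> \<Lambda> q = \<Delta> q ** adj2 (\<Lambda> q)"
proof -
  define g where "g = transpose (\<Omega> q) ** \<Omega> q"
  have "g ** matrix_inv g = mat 1"
    using matrix_inv_right assms(2) unfolding g_def by blast
  moreover have "transpose (\<Omega> q) ** jac \<xi> q = g ** transpose (\<Delta> q)"
    unfolding assms(1) g_def by (simp add: matrix_mul_assoc)
  ultimately show ?thesis
    unfolding alpha_mat_def Let_def g_def[symmetric]
    by (simp add: transpose_uminus matrix_mul_uminus_left matrix_transpose_mul g_def transpose_gram_matrix
        flip: matrix_mul_assoc)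
qed

lemma kummer_K_eq:
  assumes "jac x q = \<Omega> q ** transpose (\<Lambda> q)"
  defines "g \<equiv> transpose (\<Omega> q) ** \<Omega> q"
  shows "kummer_K \<Omega> x \<Delta> q
    = (\<lambda>c. (c \<bullet> (((- (g ** transpose (\<Lambda> q))) ** adj2 (transpose (\<Delta> q))) *v c)) / (c \<bullet> (g *v c)))"
  unfolding kummer_K_def Let_def assms(1) g_def by (simp add: matrix_mul_assoc)

lemma kummer_extremal_iff_curvature_condition_at:
  assumes "open U" "q \<in> U" and x: "smooth_on U x"
    and singular: "singular_set U x = singular_set U \<xi>"
    and normal: "unit_normal_of U x \<xi>" and basis: "tangent_moving_basis U x \<xi> \<Omega>"
    and jac_x: "jac x q = \<Omega> q ** transpose (\<Lambda> q)" and jac_\<xi>: "jac \<xi> q = \<Omega> q ** transpose (\<Delta> q)"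
  shows "(transpose (\<Delta> q) *v v \<noteq> 0 \<longrightarrow> extremal_on (kummer_K \<Omega> x \<Delta> q) (- {0}) (transpose (\<Delta> q) *v v))
    \<longleftrightarrow> det (\<Lambda> q) * (v \<bullet> ((Pmat ** transpose (alpha_mat \<Omega> \<xi> \<Lambda> q)) *v v)) = 0"
proof -
  define g where "g = transpose (\<Omega> q) ** \<Omega> q"
  have \<xi>: "smooth_on U \<xi>"
    and orthogonal: "\<And>w i. w \<in> U \<Longrightarrow> i \<in> Basis \<Longrightarrow> \<xi> w \<bullet> frechet_derivative x (at w) i = 0"
    using normal unfolding unit_normal_of_def by auto
  have "inj ((*v) (\<Omega> q))"
    using basis \<open>q \<in> U\<close> unfolding tangent_moving_basis_def
    by (blast intro: inj_matrix_vector_mult_if_columns_independent)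
  then have g_pos: "\<And>c. c \<noteq> 0 \<Longrightarrow> 0 < c \<bullet> (g *v c)"
    unfolding g_def by (rule gram_matrix_positive_definite)
  have dx: "x differentiable (at q)" and d\<xi>: "\<xi> differentiable (at q)"
    using smooth_on_differentiable x \<xi> \<open>q \<in> U\<close> by blast+
  have "transpose (jac x q) ** jac \<xi> q = \<Lambda> q ** g ** transpose (\<Delta> q)"
    unfolding jac_x jac_\<xi> g_def by (simp add: matrix_transpose_mul matrix_mul_assoc)
  moreover have "(transpose (jac x q) ** jac \<xi> q)$i$j = (transpose (jac x q) ** jac \<xi> q)$j$i" for i j
    using normal_derivative_inner_symmetric[OF assms(1,2) x \<xi> orthogonal, of "axis i 1" "axis j 1"]
    by (simp add: inner_mult_axis[symmetric] jac_mult dx d\<xi> inner_commute)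
  ultimately have "transpose (\<Lambda> q ** g ** transpose (\<Delta> q)) = \<Lambda> q ** g ** transpose (\<Delta> q)"
    by (simp add: vec_eq_iff transpose_def)
  moreover have "det (\<Lambda> q) = 0 \<longleftrightarrow> det (\<Delta> q) = 0"
    using singular_set_iff_det[OF \<open>inj ((*v) (\<Omega> q))\<close> dx jac_x \<open>q \<in> U\<close>]
      singular_set_iff_det[OF \<open>inj ((*v) (\<Omega> q))\<close> d\<xi> jac_\<xi> \<open>q \<in> U\<close>] singular by simp
  moreover have "alpha_mat \<Omega> \<xi> \<Lambda> q = \<Delta> q ** adj2 (\<Lambda> q)"
    using alpha_mat_eq[where \<Omega> = \<Omega> and \<Delta> = \<Delta>, OF jac_\<xi>] det_nonzero_if_positive_definite[OF g_pos]
    by (simp add: g_def invertible_det_nz)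
  ultimately show ?thesis
    using kummer_extremal_iff_curvature_condition[OF transpose_gram_matrix g_pos[unfolded g_def]]
    unfolding kummer_K_eq[where \<Omega> = \<Omega> and \<Lambda> = \<Lambda>, OF jac_x] g_def by simp
qed

theorem corollary4p3:
  fixes U :: "(real^2) set" and x \<xi> :: "real^2 \<Rightarrow> real^3"
    and \<Omega> :: "real^2 \<Rightarrow> real^2^3" and \<Lambda> \<Delta> :: "real^2 \<Rightarrow> real^2^2"
    and I :: "real set" and \<gamma> :: "real \<Rightarrow> real^2"
  assumes "open U"
    and "proper_frontal U x" and "proper_frontal U \<xi>"
    and "singular_set U x = singular_set U \<xi>"
    and "unit_normal_of U x \<xi>"
    and "tangent_moving_basis U x \<xi> \<Omega>"
    and "\<forall>u\<in>U. jac x u = \<Omega> u ** transpose (\<Lambda> u)"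
    and "\<forall>u\<in>U. jac \<xi> u = \<Omega> u ** transpose (\<Delta> u)"
    and "open I" and "is_interval I" and "I \<noteq> {}"
    and "smooth_on I \<gamma>" and "\<gamma> ` I \<subseteq> U"
  shows "kummer_principal_line \<Omega> x \<Delta> I \<gamma> \<longleftrightarrow> line_of_curvature \<Omega> \<xi> \<Lambda> I \<gamma>"
proof -
  have "smooth_on U x"
    using assms(2) unfolding proper_frontal_def frontal_def by blast
  then have "\<And>t. t \<in> I \<Longrightarrow> (transpose (\<Delta> (\<gamma> t)) *v vector_derivative \<gamma> (at t) \<noteq> 0 \<longrightarrow>
        extremal_on (kummer_K \<Omega> x \<Delta> (\<gamma> t)) (- {0}) (transpose (\<Delta> (\<gamma> t)) *v vector_derivative \<gamma> (at t)))
      \<longleftrightarrow> det (\<Lambda> (\<gamma> t)) *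
        (vector_derivative \<gamma> (at t) \<bullet> ((Pmat ** transpose (alpha_mat \<Omega> \<xi> \<Lambda> (\<gamma> t))) *v vector_derivative \<gamma> (at t))) = 0"
    using assms(1,4-8,13) by (intro kummer_extremal_iff_curvature_condition_at) auto
  then show ?thesis
    unfolding kummer_principal_line_def line_of_curvature_def Let_def extremal_on_def Ball_def
      Compl_iff singleton_iff by simp
qed

end
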